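(* Let $1<\alpha<\beta$. If the set $[0,1]\cup[\alpha,\beta]$ is a spectral set, then it tiles the real line by translations.
   Context: A set $\Omega\subset\mathbb{R}$ of finite positive measure is a spectral set if there is a discrete set $\Lambda\subset\mathbb{R}$ such that $\{e_\lambda : \lambda\in\Lambda\}$, $e_\lambda(x)=e^{i2\pi\lambda x}$, is an orthogonal basis of $L^2(\Omega)$. $\Omega$ tiles the real line by translations if there is a set $A\subset\mathbb{R}$ (a tiling set) such that $\sum_{a\in A}\chi_\Omega(t-a)=1$ for a.e. $t\in\mathbb{R}$. *)

theory Defs
  imports "HOL-Analysis.Analysis"
begin

text \<open>
  Square-integrable complex functions, as functions rather than almost-everywhere classes:
  two functions represent the same element iff \<open>L2_norm\<close> of their difference vanishes.
\<close>

definition L2_fun :: "'a measure \<Rightarrow> ('a \<Rightarrow> complex) set" where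
  "L2_fun M = {f \<in> borel_measurable M. integrable M (\<lambda>x. (norm (f x))\<^sup>2)}"

definition L2_inner :: "'a measure \<Rightarrow> ('a \<Rightarrow> complex) \<Rightarrow> ('a \<Rightarrow> complex) \<Rightarrow> complex" where
  "L2_inner M f g = (LINT x|M. f x * cnj (g x))"

definition L2_norm :: "'a measure \<Rightarrow> ('a \<Rightarrow> complex) \<Rightarrow> real" where
  "L2_norm M f = sqrt (LINT x|M. (norm (f x))\<^sup>2)"

text \<open>
  An orthogonal basis is a family of nonzero, pairwise orthogonal elements whose finite
  linear combinations are dense. No countability of the index set is imposed.
\<close>

definition L2_orthogonal_basis :: "'a measure \<Rightarrow> 'i set \<Rightarrow> ('i \<Rightarrow> 'a \<Rightarrow> complex) \<Rightarrow> bool" where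
  "L2_orthogonal_basis M I e \<longleftrightarrow>
     (\<forall>i\<in>I. e i \<in> L2_fun M \<and> L2_norm M (e i) \<noteq> 0) \<and>
     (\<forall>i\<in>I. \<forall>j\<in>I. i \<noteq> j \<longrightarrow> L2_inner M (e i) (e j) = 0) \<and>
     (\<forall>f\<in>L2_fun M. \<forall>\<epsilon>>0. \<exists>F c. finite F \<and> F \<subseteq> I \<and>
        L2_norm M (\<lambda>x. f x - (\<Sum>i\<in>F. c i * e i x)) < \<epsilon>)"

definition expo :: "real \<Rightarrow> real \<Rightarrow> complex" where
  "expo \<nu> x = exp (\<i> * complex_of_real (2 * pi * \<nu> * x))"

definition spectral_set :: "real set \<Rightarrow> bool" where
  "spectral_set \<Omega> \<longleftrightarrow>
     \<Omega> \<in> sets lebesgue \<and> 0 < emeasure lebesgue \<Omega> \<and> emeasure lebesgue \<Omega> < \<infinity> \<and>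
     (\<exists>\<Lambda>. discrete \<Lambda> \<and> L2_orthogonal_basis (lebesgue_on \<Omega>) \<Lambda> expo)"

text \<open>
  The tiling set is an arbitrary set of reals, so the sum is an unordered one;
  \<open>has_sum\<close> includes its convergence.
\<close>

definition tiles_by_translations :: "real set \<Rightarrow> bool" where
  "tiles_by_translations \<Omega> \<longleftrightarrow>
     (\<exists>A :: real set. AE t in lebesgue. ((\<lambda>a. indicat_real \<Omega> (t - a)) has_sum 1) A)"

end

theory Submission
  imports Defs
begin

text \<open>
  Let \<open>\<Lambda>\<close> be a spectrum of \<open>\<Omega> = [0,1] \<union> [\<alpha>,\<beta>]\<close> and \<open>e(x) = exp (2\<pi>\<i>x)\<close>. The argument plays the two halves
  of the basis property against each other.

  Orthogonality restricts the differences \<open>t\<close> of frequencies: the Fourier transform of the indicator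
  of \<open>\<Omega>\<close> vanishes at \<open>t \<noteq> 0\<close> iff \<open>1 + e(\<alpha>t) = e(t) + e(\<beta>t)\<close>
  (\<open>orthogonal_expo_union_intervals\<close>). Four unit numbers satisfy such an equation only in degenerate
  ways: the two sides have the same summands, or both are zero (\<open>unit_quadrilateral\<close>). Since the
  equation holds for all differences, after translating the spectrum to contain \<open>0\<close> the degeneration
  is the same throughout (\<open>quadrilateral_family_trichotomy\<close>):
  either all frequencies have \<open>e(t) = 1\<close>; or all have \<open>e(t) = e(\<alpha>t)\<close> and \<open>e(\<beta>t) = 1\<close>;
  or \<open>(e(\<alpha>t), e(t), e(\<beta>t))\<close> takes only the values \<open>(1, 1, 1)\<close> and \<open>(-1, w, -w)\<close>.

  Completeness forbids too much regularity: no nontrivial linear combination of evaluations at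
  distinct interior points of \<open>\<Omega>\<close> can annihilate all exponentials of the spectrum
  (\<open>expo_evaluations_independent\<close>). In particular the exponentials have no common period that
  carries one interior point of \<open>\<Omega>\<close> to another.

  In the first case \<open>1\<close> is a common period, which is impossible because \<open>\<Omega>\<close> is longer than \<open>1\<close>.
  In the second case \<open>L = 1 + \<beta> - \<alpha>\<close> and \<open>\<alpha> - 1\<close> are common periods, hence so are the residue
  \<open>\<theta>\<close> of \<open>\<alpha> - 1\<close> modulo \<open>L\<close> and \<open>L - \<theta>\<close>; neither can be positive and shorter than one of the
  intervals, which leaves \<open>\<theta> = 0\<close>, or two unit intervals and \<open>\<theta> = 1\<close>. In the third case
  \<open>\<beta> - \<alpha> - 1\<close> is a common period, which forces two unit intervals; and if \<open>\<alpha>\<close> had a fractional part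
  \<open>\<theta> > 0\<close>, then evaluations at three points \<open>y\<close>, \<open>y + \<theta>\<close>, \<open>y + \<alpha>\<close> of \<open>\<Omega>\<close> would be linearly
  dependent, since up to a common factor the triple of their values is one of two vectors. So either \<open>\<alpha> - 1\<close>
  is a multiple of \<open>L\<close>, and \<open>\<Omega>\<close> is a fundamental domain of \<open>L\<int>\<close>, or \<open>\<Omega>\<close> consists of two unit
  intervals at an integer distance; both sets tile explicitly.
\<close>

section \<open>Square-integrable functions\<close>

lemma L2_fun_scale: "f \<in> L2_fun M \<Longrightarrow> (\<lambda>x. c * f x) \<in> L2_fun M"
  by (auto simp: L2_fun_def norm_mult power_mult_distrib)

lemma L2_fun_mult_cnj_integrable:
  assumes "f \<in> L2_fun M" "g \<in> L2_fun M"
  shows "integrable M (\<lambda>x. f x * cnj (g x))"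
proof (rule Bochner_Integration.integrable_bound)
  show "integrable M (\<lambda>x. (norm (f x))\<^sup>2 + (norm (g x))\<^sup>2)"
    using assms by (auto simp: L2_fun_def)
  show "(\<lambda>x. f x * cnj (g x)) \<in> borel_measurable M"
    using assms by (auto simp: L2_fun_def intro!: borel_measurable_times borel_measurable_continuous_on[OF continuous_on_cnj])
  have "norm (u * cnj v) \<le> norm ((norm u)\<^sup>2 + (norm v)\<^sup>2)" for u v :: complex
  proof -
    have "2 * norm u * norm v \<le> (norm u)\<^sup>2 + (norm v)\<^sup>2"
      by (rule sum_squares_bound)
    moreover have "0 \<le> norm u * norm v" by simp
    ultimately have "norm u * norm v \<le> \<bar>(norm u)\<^sup>2 + (norm v)\<^sup>2\<bar>" by linarith
    thus ?thesis by (simp add: norm_mult)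
  qed
  thus "AE x in M. norm (f x * cnj (g x)) \<le> norm ((norm (f x))\<^sup>2 + (norm (g x))\<^sup>2)"
    by simp
qed

lemma L2_fun_add:
  assumes "f \<in> L2_fun M" "g \<in> L2_fun M"
  shows "(\<lambda>x. f x + g x) \<in> L2_fun M"
proof -
  have eq: "(norm (u + v))\<^sup>2 = (norm u)\<^sup>2 + (norm v)\<^sup>2 + 2 * Re (u * cnj v)" for u v :: complex
    unfolding cmod_power2 by (simp add: power2_eq_square algebra_simps)
  have "integrable M (\<lambda>x. (norm (f x))\<^sup>2 + (norm (g x))\<^sup>2 + 2 * Re (f x * cnj (g x)))"
    using assms L2_fun_mult_cnj_integrable[OF assms]
    unfolding L2_fun_def
    by (intro Bochner_Integration.integrable_add integrable_mult_right integrable_Re) auto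
  thus ?thesis
    using assms unfolding eq L2_fun_def by (auto simp: eq)
qed

lemma L2_fun_sum:
  assumes "\<And>i. i \<in> F \<Longrightarrow> f i \<in> L2_fun M"
  shows "(\<lambda>x. \<Sum>i\<in>F. f i x) \<in> L2_fun M"
  using assms
proof (induction F rule: infinite_finite_induct)
  case (insert i F)
  thus ?case using L2_fun_add[of "f i" M "\<lambda>x. \<Sum>i\<in>F. f i x"] by simp
qed (auto simp: L2_fun_def)

lemma L2_inner_scale_left: "L2_inner M (\<lambda>x. c * f x) g = c * L2_inner M f g"
  by (simp add: L2_inner_def mult.assoc)

lemma L2_inner_scale_right: "L2_inner M f (\<lambda>x. c * g x) = cnj c * L2_inner M f g"
  by (simp add: L2_inner_def mult.left_commute)

lemma L2_inner_sum_right: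
  assumes "f \<in> L2_fun M" "\<And>i. i \<in> F \<Longrightarrow> g i \<in> L2_fun M"
  shows "L2_inner M f (\<lambda>x. \<Sum>i\<in>F. g i x) = (\<Sum>i\<in>F. L2_inner M f (g i))"
  using assms by (simp add: L2_inner_def sum_distrib_left L2_fun_mult_cnj_integrable)

lemma L2_inner_sum_left:
  assumes "g \<in> L2_fun M" "\<And>i. i \<in> F \<Longrightarrow> f i \<in> L2_fun M"
  shows "L2_inner M (\<lambda>x. \<Sum>i\<in>F. f i x) g = (\<Sum>i\<in>F. L2_inner M (f i) g)"
  using assms by (simp add: L2_inner_def sum_distrib_right L2_fun_mult_cnj_integrable)

text \<open>
  By Pythagoras, a function orthogonal to the family is at distance at least its own norm from every
  finite linear combination, so density forces that norm to be zero.
\<close>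

lemma L2_norm_zero_if_orthogonal_to_basis:
  assumes basis: "L2_orthogonal_basis M I e"
    and f: "f \<in> L2_fun M" and orth: "\<And>i. i \<in> I \<Longrightarrow> L2_inner M f (e i) = 0"
  shows "L2_norm M f = 0"
proof (rule ccontr)
  assume "L2_norm M f \<noteq> 0"
  hence "0 < L2_norm M f" by (simp add: L2_norm_def less_le)
  with basis f obtain F c where F: "finite F" "F \<subseteq> I"
    and less: "L2_norm M (\<lambda>x. f x - (\<Sum>i\<in>F. c i * e i x)) < L2_norm M f"
    unfolding L2_orthogonal_basis_def by meson
  define g where "g = (\<lambda>x. \<Sum>i\<in>F. c i * e i x)"
  have e: "e i \<in> L2_fun M" if "i \<in> F" for i
    using basis F that by (auto simp: L2_orthogonal_basis_def)
  have g: "g \<in> L2_fun M"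
    unfolding g_def by (intro L2_fun_sum L2_fun_scale e)
  have "L2_inner M f g = (\<Sum>i\<in>F. cnj (c i) * L2_inner M f (e i))"
    unfolding g_def by (subst L2_inner_sum_right) (auto simp: f e L2_fun_scale L2_inner_scale_right)
  also have "\<dots> = 0"
    using orth F by (intro sum.neutral) auto
  finally have "(LINT x|M. f x * cnj (g x)) = 0" by (simp add: L2_inner_def)
  moreover have int: "integrable M (\<lambda>x. f x * cnj (g x))"
    by (rule L2_fun_mult_cnj_integrable[OF f g])
  ultimately have Re0: "(LINT x|M. Re (f x * cnj (g x))) = 0"
    by (simp del: Re_complex_of_real times_complex.simps)
  have f2: "integrable M (\<lambda>x. (norm (f x))\<^sup>2)" and g2: "integrable M (\<lambda>x. (norm (g x))\<^sup>2)"
    using f g by (auto simp: L2_fun_def)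
  have eq: "(norm (u - v))\<^sup>2 = (norm u)\<^sup>2 + (norm v)\<^sup>2 - 2 * Re (u * cnj v)" for u v :: complex
    unfolding cmod_power2 by (simp add: power2_eq_square algebra_simps)
  have "(LINT x|M. (norm (f x - g x))\<^sup>2)
      = (LINT x|M. (norm (f x))\<^sup>2) + (LINT x|M. (norm (g x))\<^sup>2) - 2 * (LINT x|M. Re (f x * cnj (g x)))"
    unfolding eq using f2 g2 integrable_Re[OF int]
    by (simp del: times_complex.simps integral_Re)
  also have "\<dots> \<ge> (LINT x|M. (norm (f x))\<^sup>2)"
    unfolding Re0 by simp
  finally have "L2_norm M f \<le> L2_norm M (\<lambda>x. f x - g x)"
    by (simp add: L2_norm_def)
  with less show False by (simp add: g_def)
qed

section \<open>Exponentials\<close>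

lemma expo_add_right: "expo \<nu> (x + y) = expo \<nu> x * expo \<nu> y"
  by (simp add: expo_def algebra_simps flip: exp_add)

lemma expo_diff_right: "expo \<nu> (x - y) = expo \<nu> x * cnj (expo \<nu> y)"
  by (simp add: expo_def algebra_simps exp_cnj flip: exp_add)

lemma expo_add_left: "expo (\<mu> + \<nu>) x = expo \<mu> x * expo \<nu> x"
  by (simp add: expo_def algebra_simps flip: exp_add)

lemma expo_diff_left: "expo (\<mu> - \<nu>) x = expo \<mu> x * cnj (expo \<nu> x)"
  by (simp add: expo_def algebra_simps exp_cnj flip: exp_add)

lemma norm_expo [simp]: "norm (expo \<nu> x) = 1"
  by (simp add: expo_def)

lemma expo_zero [simp]: "expo \<nu> 0 = 1" "expo 0 x = 1"
  by (simp_all add: expo_def)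

lemma expo_mult_cnj [simp]: "expo \<nu> x * cnj (expo \<nu> x) = 1"
  by (simp add: complex_norm_square[symmetric])

lemma expo_int_multiple:
  assumes "expo \<nu> p = 1"
  shows "expo \<nu> (of_int k * p) = 1"
proof -
  have "expo \<nu> (of_int k * p) = expo \<nu> p powi k"
    by (simp add: expo_def exp_power_int algebra_simps)
  thus ?thesis using assms by simp
qed

lemma continuous_on_expo [continuous_intros]: "continuous_on A (expo \<nu>)"
  unfolding expo_def by (intro continuous_intros)

lemma borel_measurable_cnj_expo: "(\<lambda>x. cnj (expo \<nu> x)) \<in> borel_measurable borel"
  by (intro borel_measurable_continuous_onI continuous_intros)

lemma expo_has_integral:
  assumes "\<nu> \<noteq> 0" "a \<le> b"
  shows "(expo \<nu> has_integral (expo \<nu> b - expo \<nu> a) / (\<i> * of_real (2 * pi * \<nu>))) {a..b}"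
proof -
  have "((\<lambda>x. expo \<nu> x / (\<i> * of_real (2 * pi * \<nu>))) has_vector_derivative expo \<nu> x) (at x within {a..b})" for x
    unfolding expo_def using assms
    by (auto intro!: derivative_eq_intros has_vector_derivative_real_field simp: field_simps)
  from fundamental_theorem_of_calculus[OF assms(2) this] show ?thesis
    by (simp add: diff_divide_distrib)
qed

text \<open>
  This says that \<open>e(tx)\<close> has integral zero over the union for \<open>t = \<mu> - \<nu> \<noteq> 0\<close>, with the antiderivative evaluated and the
  factor \<open>2\<pi>\<i>t\<close> cancelled. The form is chosen so that it also holds for \<open>t = 0\<close>.
\<close>

lemma orthogonal_expo_union_intervals:
  assumes ord: "(1::real) < \<alpha>" "\<alpha> < \<beta>"
    and basis: "L2_orthogonal_basis (lebesgue_on ({0..1} \<union> {\<alpha>..\<beta>})) \<Lambda> expo"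
    and "\<mu> \<in> \<Lambda>" "\<nu> \<in> \<Lambda>"
  shows "1 + expo (\<mu> - \<nu>) \<alpha> = expo (\<mu> - \<nu>) 1 + expo (\<mu> - \<nu>) \<beta>"
proof (cases "\<mu> = \<nu>")
  case False
  define \<Omega> where "\<Omega> = {0..1} \<union> {\<alpha>..\<beta>}"
  define t where "t = \<mu> - \<nu>"
  have t: "t \<noteq> 0" using False by (simp add: t_def)
  have L2: "expo \<mu> \<in> L2_fun (lebesgue_on \<Omega>)" "expo \<nu> \<in> L2_fun (lebesgue_on \<Omega>)"
    and orth: "L2_inner (lebesgue_on \<Omega>) (expo \<mu>) (expo \<nu>) = 0"
    using basis assms(4,5) False by (auto simp: L2_orthogonal_basis_def \<Omega>_def)
  have "integrable (lebesgue_on \<Omega>) (expo t)"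
    using L2_fun_mult_cnj_integrable[OF L2] by (simp add: t_def expo_diff_left[abs_def])
  hence "integral \<Omega> (expo t) = (LINT x|lebesgue_on \<Omega>. expo t x)"
    by (simp add: lebesgue_integral_eq_integral \<Omega>_def)
  also have "\<dots> = 0"
    using orth by (simp add: L2_inner_def t_def expo_diff_left)
  finally have "integral \<Omega> (expo t) = 0" .
  moreover have "{0..1} \<inter> {\<alpha>..\<beta>} = {}" using ord by auto
  hence "(expo t has_integral (expo t 1 - expo t 0) / (\<i> * of_real (2 * pi * t))
      + (expo t \<beta> - expo t \<alpha>) / (\<i> * of_real (2 * pi * t))) \<Omega>"
    unfolding \<Omega>_def using ord t
    by (intro has_integral_Un expo_has_integral) auto
  ultimately have "(expo t 1 - expo t 0) / (\<i> * of_real (2 * pi * t))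
      + (expo t \<beta> - expo t \<alpha>) / (\<i> * of_real (2 * pi * t)) = 0"
    by (metis integral_unique)
  hence "expo t 1 - 1 + (expo t \<beta> - expo t \<alpha>) = 0"
    using t by (simp add: add_divide_distrib[symmetric])
  thus ?thesis unfolding t_def[symmetric] by (simp add: algebra_simps)
qed simp

section \<open>Point evaluations\<close>

text \<open>
  Averaging an exponential over a ball multiplies its value at the centre by a factor that depends
  on the radius and the frequency only, so a relation between point values is inherited by averages.
\<close>

lemma integral_expo_cball:
  "(LINT x|lborel. indicator (cball y \<epsilon>) x * cnj (expo \<nu> x))
     = cnj (expo \<nu> y) * (LINT x|lborel. indicator (cball 0 \<epsilon>) x * cnj (expo \<nu> x))"
proof -
  have "(LINT x|lborel. indicator (cball y \<epsilon>) x * cnj (expo \<nu> x))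
      = (LINT x|lborel. indicator (cball y \<epsilon>) (y + x) * cnj (expo \<nu> (y + x)))"
    using lborel_integral_real_affine[of 1 "\<lambda>x. indicator (cball y \<epsilon>) x * cnj (expo \<nu> x)" y] by simp
  also have "\<dots> = (LINT x|lborel. cnj (expo \<nu> y) * (indicator (cball 0 \<epsilon>) x * cnj (expo \<nu> x)))"
    by (intro Bochner_Integration.integral_cong) (auto simp: expo_add_right indicator_def dist_norm)
  finally show ?thesis by simp
qed

text \<open>
  If a combination of evaluations annihilated the spectrum, then so would the same combination of
  averages over small disjoint intervals around the points. This is an inner product with a step
  function, which would be orthogonal to the whole basis and hence zero. The shift by \<open>\<nu>\<^sub>0\<close> only
  changes the coefficients by unit factors; it lets the spectrum be normalised to contain \<open>0\<close>.
\<close>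

lemma expo_evaluations_independent:
  fixes \<Omega> :: "real set"
  assumes meas: "\<Omega> \<in> sets lebesgue" and fin: "emeasure lebesgue \<Omega> < \<infinity>"
    and basis: "L2_orthogonal_basis (lebesgue_on \<Omega>) \<Lambda> expo"
    and Y: "finite Y" "Y \<subseteq> interior \<Omega>"
    and rel: "\<And>\<nu>. \<nu> \<in> \<Lambda> \<Longrightarrow> (\<Sum>y\<in>Y. c y * expo (\<nu> - \<nu>\<^sub>0) y) = 0"
    and y0: "y\<^sub>0 \<in> Y"
  shows "c y\<^sub>0 = 0"
proof -
  let ?M = "lebesgue_on \<Omega>"
  \<comment> \<open>A radius for which the balls lie in the set and the one around the chosen point meets no other.\<close>
  have "\<forall>y\<in>Y. \<forall>\<^sub>F \<epsilon> in at_right 0. cball y \<epsilon> \<subseteq> \<Omega> \<and> (y \<noteq> y\<^sub>0 \<longrightarrow> 2 * \<epsilon> < dist y y\<^sub>0)"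
  proof
    fix y assume "y \<in> Y"
    then obtain d where d: "d > 0" "cball y d \<subseteq> \<Omega>"
      using Y(2) by (meson mem_interior_cball subsetD)
    have "\<forall>\<^sub>F \<epsilon> in at_right 0. cball y \<epsilon> \<subseteq> \<Omega>"
      unfolding eventually_at_right_field using d
      by (intro exI[of _ d]) (auto simp: subset_iff)
    moreover have "\<forall>\<^sub>F \<epsilon> in at_right 0. y \<noteq> y\<^sub>0 \<longrightarrow> 2 * \<epsilon> < dist y y\<^sub>0"
    proof (cases "y = y\<^sub>0")
      case False
      thus ?thesis unfolding eventually_at_right_field
        by (intro exI[of _ "dist y y\<^sub>0 / 2"]) auto
    qed simp
    ultimately show "\<forall>\<^sub>F \<epsilon> in at_right 0. cball y \<epsilon> \<subseteq> \<Omega> \<and> (y \<noteq> y\<^sub>0 \<longrightarrow> 2 * \<epsilon> < dist y y\<^sub>0)"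
      by (rule eventually_conj)
  qed
  hence "\<forall>\<^sub>F \<epsilon> in at_right 0. \<forall>y\<in>Y. cball y \<epsilon> \<subseteq> \<Omega> \<and> (y \<noteq> y\<^sub>0 \<longrightarrow> 2 * \<epsilon> < dist y y\<^sub>0)"
    using Y(1) by (rule eventually_ball_finite[rotated])
  hence "\<forall>\<^sub>F \<epsilon> in at_right 0. \<epsilon> > 0 \<and> (\<forall>y\<in>Y. cball y \<epsilon> \<subseteq> \<Omega> \<and> (y \<noteq> y\<^sub>0 \<longrightarrow> 2 * \<epsilon> < dist y y\<^sub>0))"
    by (intro eventually_conj eventually_at_right_less)
  then obtain \<epsilon> where \<epsilon>: "\<epsilon> > 0" and sub: "\<And>y. y \<in> Y \<Longrightarrow> cball y \<epsilon> \<subseteq> \<Omega>"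
    and far: "\<And>y. y \<in> Y \<Longrightarrow> y \<noteq> y\<^sub>0 \<Longrightarrow> 2 * \<epsilon> < dist y y\<^sub>0"
    using eventually_happens'[OF trivial_limit_at_right_real] by blast
  \<comment> \<open>The inner product conjugates the exponentials, so the coefficients are conjugated too.\<close>
  define k where "k y = cnj (c y * expo (-\<nu>\<^sub>0) y)" for y
  define \<psi> where "\<psi> y = (indicator (cball y \<epsilon>) :: real \<Rightarrow> complex)" for y
  define f where "f x = (\<Sum>y\<in>Y. k y * \<psi> y x)" for x
  have finM: "finite_measure ?M"
    using fin meas by (intro finite_measureI) (simp add: emeasure_restrict_space space_restrict_space)
  have \<psi>_meas: "\<psi> y \<in> borel_measurable ?M" for y
    unfolding \<psi>_def by (intro measurable_restrict_space1 borel_measurable_indicator) auto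
  have \<psi>: "\<psi> y \<in> L2_fun ?M" for y
  proof -
    have "(\<lambda>x. (norm (\<psi> y x))\<^sup>2) \<in> borel_measurable ?M"
      using \<psi>_meas by simp
    hence "integrable ?M (\<lambda>x. (norm (\<psi> y x))\<^sup>2)"
      by (intro finite_measure.integrable_const_bound[OF finM, of _ 1])
        (auto simp: \<psi>_def indicator_def)
    thus ?thesis using \<psi>_meas by (simp add: L2_fun_def)
  qed
  have f: "f \<in> L2_fun ?M"
    unfolding f_def by (intro L2_fun_sum L2_fun_scale \<psi>)
  have inner_\<psi>: "L2_inner ?M (\<psi> y) (expo \<nu>)
      = cnj (expo \<nu> y) * (LINT x|lborel. indicator (cball 0 \<epsilon>) x * cnj (expo \<nu> x))" if "y \<in> Y" for y \<nu>
  proof -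
    have "L2_inner ?M (\<psi> y) (expo \<nu>) = (LINT x|lebesgue. indicator \<Omega> x *\<^sub>R (\<psi> y x * cnj (expo \<nu> x)))"
      unfolding L2_inner_def using meas by (subst integral_restrict_space) auto
    also have "\<dots> = (LINT x|lebesgue. indicator (cball y \<epsilon>) x * cnj (expo \<nu> x))"
      using sub[OF that] by (intro Bochner_Integration.integral_cong) (auto simp: \<psi>_def indicator_def)
    also have "\<dots> = (LINT x|lborel. indicator (cball y \<epsilon>) x * cnj (expo \<nu> x))"
      by (intro integral_completion borel_measurable_times borel_measurable_indicator)
        (auto intro: borel_measurable_cnj_expo)
    finally show ?thesis by (rule trans[OF _ integral_expo_cball])
  qed
  have orth: "L2_inner ?M f (expo \<nu>) = 0" if \<nu>: "\<nu> \<in> \<Lambda>" for \<nu>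
  proof -
    let ?K = "LINT x|lborel. indicator (cball 0 \<epsilon>) x * cnj (expo \<nu> x)"
    have "expo \<nu> \<in> L2_fun ?M" using basis \<nu> by (auto simp: L2_orthogonal_basis_def)
    hence "L2_inner ?M f (expo \<nu>) = (\<Sum>y\<in>Y. k y * L2_inner ?M (\<psi> y) (expo \<nu>))"
      unfolding f_def
      by (subst L2_inner_sum_left) (auto simp: L2_fun_scale \<psi> L2_inner_scale_left)
    also have "\<dots> = (\<Sum>y\<in>Y. cnj (c y * expo (\<nu> - \<nu>\<^sub>0) y) * ?K)"
      using expo_add_left[of \<nu> "-\<nu>\<^sub>0"] by (intro sum.cong) (auto simp: k_def inner_\<psi>)
    also have "\<dots> = cnj (\<Sum>y\<in>Y. c y * expo (\<nu> - \<nu>\<^sub>0) y) * ?K"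
      by (simp add: sum_distrib_right)
    finally show ?thesis using rel[OF \<nu>] by simp
  qed
  have "L2_norm ?M f = 0"
    by (rule L2_norm_zero_if_orthogonal_to_basis[OF basis f orth])
  moreover have "integrable ?M (\<lambda>x. (norm (f x))\<^sup>2)" using f by (simp add: L2_fun_def)
  moreover have "(LINT x|?M. (norm (c y\<^sub>0))\<^sup>2 * indicator (cball y\<^sub>0 \<epsilon>) x) \<le> (LINT x|?M. (norm (f x))\<^sup>2)"
  proof (rule integral_mono)
    show "integrable ?M (\<lambda>x. (norm (c y\<^sub>0))\<^sup>2 * indicator (cball y\<^sub>0 \<epsilon>) x)"
      by (intro finite_measure.integrable_const_bound[OF finM, of _ "(norm (c y\<^sub>0))\<^sup>2"]
          borel_measurable_times borel_measurable_const measurable_restrict_space1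
          borel_measurable_indicator) (auto simp: indicator_def)
    show "integrable ?M (\<lambda>x. (norm (f x))\<^sup>2)" by fact
    fix x
    show "(norm (c y\<^sub>0))\<^sup>2 * indicator (cball y\<^sub>0 \<epsilon>) x \<le> (norm (f x))\<^sup>2"
    proof (cases "x \<in> cball y\<^sub>0 \<epsilon>")
      case True
      have "\<psi> y x = 0" if "y \<in> Y" "y \<noteq> y\<^sub>0" for y
        using far[OF that] True dist_triangle2[of y y\<^sub>0 x] by (auto simp: \<psi>_def indicator_def dist_commute)
      hence "f x = (\<Sum>y\<in>{y\<^sub>0}. k y * \<psi> y x)"
        unfolding f_def using Y(1) y0 by (intro sum.mono_neutral_right) auto
      also have "\<dots> = k y\<^sub>0" using True by (simp add: \<psi>_def)
      finally show ?thesis using True by (simp add: k_def norm_mult)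
    qed simp
  qed
  moreover have "(LINT x|?M. (norm (c y\<^sub>0))\<^sup>2 * indicator (cball y\<^sub>0 \<epsilon>) x) = (norm (c y\<^sub>0))\<^sup>2 * (2 * \<epsilon>)"
  proof -
    have "(LINT x|?M. indicator (cball y\<^sub>0 \<epsilon>) x) = measure ?M (cball y\<^sub>0 \<epsilon> \<inter> space ?M)"
      by simp
    also have "cball y\<^sub>0 \<epsilon> \<inter> space ?M = cball y\<^sub>0 \<epsilon>"
      using sub[OF y0] by (auto simp: space_restrict_space)
    also have "measure ?M (cball y\<^sub>0 \<epsilon>) = measure lebesgue (cball y\<^sub>0 \<epsilon>)"
      using sub[OF y0] meas by (intro measure_restrict_space) auto
    also have "\<dots> = 2 * \<epsilon>"
      using \<epsilon> by (simp add: cball_eq_atLeastAtMost)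
    finally show ?thesis by simp
  qed
  ultimately have "(norm (c y\<^sub>0))\<^sup>2 * (2 * \<epsilon>) \<le> 0"
    by (simp only: L2_norm_def real_sqrt_eq_zero_cancel_iff)
  thus ?thesis using \<epsilon> by (simp add: mult_le_0_iff)
qed

section \<open>Unit quadrilaterals\<close>

text \<open>
  A pair of unit numbers with nonzero sum is determined by the sum: conjugating \<open>1 + a = b + c\<close>
  gives \<open>(1 + a) / a = (b + c) / (b c)\<close>, so the two pairs also have the same product unless the sum
  is zero.
\<close>

lemma unit_quadrilateral:
  fixes a b c :: complex
  assumes "norm a = 1" "norm b = 1" "norm c = 1" and eq: "1 + a = b + c"
  shows "b = 1 \<and> c = a \<or> b = a \<and> c = 1 \<or> a = -1 \<and> c = -b"
proof -
  have u: "a * cnj a = 1" "b * cnj b = 1" "c * cnj c = 1"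
    using assms by (simp_all add: complex_norm_square[symmetric])
  have "1 + cnj a = cnj b + cnj c"
    using arg_cong[OF eq, of cnj] by simp
  hence "a * b * c * (1 + cnj a) = a * b * c * (cnj b + cnj c)" by simp
  hence "b * c * (a + a * cnj a) = a * (c * (b * cnj b) + b * (c * cnj c))"
    by (simp add: algebra_simps)
  hence "(1 + a) * (b * c - a) = 0"
    using eq by (simp add: u algebra_simps)
  hence "1 + a = 0 \<or> b * c = a" by simp
  thus ?thesis
  proof
    assume "1 + a = 0"
    thus ?thesis using eq by (auto simp: add_eq_0_iff)
  next
    assume bc: "b * c = a"
    have c: "c = 1 + a - b" using eq by (simp add: algebra_simps)
    have "(b - 1) * (b - a) = 0" using bc unfolding c by (simp add: algebra_simps)
    hence "b = 1 \<or> b = a" by simp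
    thus ?thesis using c by auto
  qed
qed

text \<open>
  The Gram condition says that \<open>(1, a\<^sub>i) \<mapsto> (b\<^sub>i, c\<^sub>i)\<close> extends to a unitary map of \<open>\<complex>\<^sup>2\<close>, and the
  sum condition that this map is compatible with \<open>(1, 1) \<mapsto> (1, 1)\<close>. The three outcomes are that the
  map is the identity, that it exchanges the coordinates, and that all its matrix entries are nonzero.
  In the last case the first coordinate \<open>b\<^sub>i\<close> can have modulus one for two values of \<open>a\<^sub>i\<close> only.
\<close>

lemma quadrilateral_family_trichotomy:
  fixes a b c :: "'i \<Rightarrow> complex"
  assumes norms: "\<And>i. i \<in> D \<Longrightarrow> norm (a i) = 1" "\<And>i. i \<in> D \<Longrightarrow> norm (b i) = 1" "\<And>i. i \<in> D \<Longrightarrow> norm (c i) = 1"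
    and sum: "\<And>i. i \<in> D \<Longrightarrow> 1 + a i = b i + c i"
    and gram: "\<And>i j. i \<in> D \<Longrightarrow> j \<in> D \<Longrightarrow> 1 + a i * cnj (a j) = b i * cnj (b j) + c i * cnj (c j)"
  obtains (left) "\<And>i. i \<in> D \<Longrightarrow> b i = 1"
  | (right) "\<And>i. i \<in> D \<Longrightarrow> b i = a i \<and> c i = 1"
  | (two) w where "\<And>i. i \<in> D \<Longrightarrow> a i = 1 \<and> b i = 1 \<and> c i = 1 \<or> a i = -1 \<and> b i = w \<and> c i = -w"
proof -
  have quad: "b i = 1 \<and> c i = a i \<or> b i = a i \<and> c i = 1 \<or> a i = -1 \<and> c i = - b i" if "i \<in> D" for i
    using that by (intro unit_quadrilateral norms sum)
  show thesis
  proof (cases "\<exists>j\<in>D. b j \<noteq> 1 \<and> b j \<noteq> a j")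
    case True
    then obtain j where j: "j \<in> D" "b j \<noteq> 1" "b j \<noteq> a j" by blast
    with quad[of j] have aj: "a j = -1" "c j = - b j" by auto
    have "a i = 1 \<and> b i = 1 \<and> c i = 1 \<or> a i = -1 \<and> b i = b j \<and> c i = - b j" if i: "i \<in> D" for i
    proof -
      have "b j * cnj (b j) = 1"
        using norms(2)[OF j(1)] by (simp add: complex_norm_square[symmetric])
      moreover have "1 - a i = (b i - c i) * cnj (b j)"
        using gram[OF i j(1)] by (simp add: aj algebra_simps)
      ultimately have d: "b j * (1 - a i) = b i - c i"
        by (metis mult.commute mult.left_commute mult_1)
      consider "b i = 1" "c i = a i" | "b i = a i" "c i = 1" | "a i = -1" "c i = - b i"
        using quad[OF i] by blast
      thus ?thesis
      proof cases
        case 1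
        with d j(2) show ?thesis by auto
      next
        case 2
        have "b j * (1 - a i) = a i - 1" using d 2 by simp
        hence "(b j + 1) * (1 - a i) = 0" by (simp only: distrib_right) simp
        moreover have "b j + 1 \<noteq> 0" using j(3) aj by (auto simp: add_eq_0_iff2)
        ultimately show ?thesis using 2 by simp
      next
        case 3
        with d show ?thesis by simp
      qed
    qed
    thus thesis by (rule two)
  next
    case False
    hence split: "b i = 1 \<and> c i = a i \<or> b i = a i \<and> c i = 1" if "i \<in> D" for i
      using that sum[OF that] by auto
    show thesis
    proof (cases "\<exists>j\<in>D. b j \<noteq> 1")
      case True
      then obtain j where j: "j \<in> D" "b j \<noteq> 1" by blast
      hence bj: "b j = a j" "c j = 1" using split by auto
      have "b i = a i \<and> c i = 1" if i: "i \<in> D" for i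
      proof (rule ccontr)
        assume "\<not> (b i = a i \<and> c i = 1)"
        hence bi: "b i = 1" "c i = a i" using split[OF i] by auto
        have "(1 - a i) * (1 - cnj (a j)) = 0"
          using gram[OF i j(1)] by (simp add: bi bj algebra_simps)
        moreover have "a j \<noteq> 1" using j bj by simp
        ultimately have "a i = 1" by simp
        with bi \<open>\<not> (b i = a i \<and> c i = 1)\<close> show False by simp
      qed
      thus thesis by (rule right)
    next
      case False
      thus thesis by (intro left) blast
    qed
  qed
qed

section \<open>Tilings\<close>

text \<open>
  The countable set \<open>N\<close> is for the points that lie on the boundary of some translate, where tiles may
  overlap.
\<close>

lemma tiles_by_translationsI:
  assumes "countable N" and unique: "\<And>t. t \<notin> N \<Longrightarrow> \<exists>!a. a \<in> A \<and> t - a \<in> \<Omega>"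
  shows "tiles_by_translations \<Omega>"
  unfolding tiles_by_translations_def
proof (intro exI)
  have "N \<in> null_sets lebesgue"
    using countable_imp_null_set_lborel[OF assms(1)] by (rule null_sets_completionI)
  hence "AE t in lebesgue. t \<notin> N" by (rule AE_not_in)
  thus "AE t in lebesgue. ((\<lambda>a. indicat_real \<Omega> (t - a)) has_sum 1) A"
  proof (rule AE_mp, intro AE_I2 impI)
    fix t assume "t \<notin> N"
    then obtain a where a: "a \<in> A" "t - a \<in> \<Omega>" and u: "\<And>b. b \<in> A \<Longrightarrow> t - b \<in> \<Omega> \<Longrightarrow> b = a"
      using unique by metis
    have "((\<lambda>a. indicat_real \<Omega> (t - a)) has_sum (\<Sum>b\<in>{a}. indicat_real \<Omega> (t - b))) {a}"
      by (rule has_sum_finite) simp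
    hence "((\<lambda>a. indicat_real \<Omega> (t - a)) has_sum 1) {a}" using a by simp
    moreover have "((\<lambda>a. indicat_real \<Omega> (t - a)) has_sum 1) {a}
        \<longleftrightarrow> ((\<lambda>a. indicat_real \<Omega> (t - a)) has_sum 1) A"
    proof (rule has_sum_cong_neutral)
      fix b assume "b \<in> A - {a}"
      thus "indicat_real \<Omega> (t - b) = 0" using u[of b] by (auto simp: indicator_def)
    qed (use a in auto)
    ultimately show "((\<lambda>a. indicat_real \<Omega> (t - a)) has_sum 1) A" by simp
  qed
qed

text \<open>
  Modulo \<open>L = 1 + \<beta> - \<alpha>\<close> the second interval becomes \<open>[1,L]\<close>, so the union is a fundamental domain
  of the lattice \<open>L\<int>\<close>.
\<close>

lemma tiles_if_complementary_mod_length: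
  fixes \<alpha> \<beta> :: real and k :: int
  assumes "1 < \<alpha>" "\<alpha> < \<beta>" and k: "\<alpha> - 1 = of_int k * (1 + \<beta> - \<alpha>)"
  shows "tiles_by_translations ({0..1} \<union> {\<alpha>..\<beta>})"
proof -
  define L where "L = 1 + \<beta> - \<alpha>"
  have L: "L > 1" using assms by (simp add: L_def)
  have \<alpha>: "\<alpha> = 1 + of_int k * L" and \<beta>: "\<beta> = L + of_int k * L"
    using k by (simp_all add: L_def algebra_simps)
  define N where "N = range (\<lambda>m. of_int m * L) \<union> range (\<lambda>m. of_int m * L + 1)"
  have mult_bounds: "m = 0" if "- L < of_int m * L" "of_int m * L < L" for m :: int
  proof -
    have "of_int m < (1::real)" "(-1::real) < of_int m"
      using that L mult_less_cancel_right_pos[of L "of_int m" 1] mult_less_cancel_right_pos[of L "-1" "of_int m"] by auto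
    thus ?thesis by linarith
  qed
  show ?thesis
  proof (rule tiles_by_translationsI[where N = N and A = "range (\<lambda>m. of_int m * L)"])
    show "countable N" by (simp add: N_def)
    fix t assume t: "t \<notin> N"
    define m where "m = \<lfloor>t / L\<rfloor>"
    define s where "s = t - of_int m * L"
    have "of_int m \<le> t / L" "t / L < of_int m + 1" by (simp_all add: m_def)
    hence "0 \<le> s" "s < L" using L by (simp_all add: s_def field_simps)
    moreover have "s \<noteq> 0" "s \<noteq> 1" using t by (auto simp: N_def s_def algebra_simps)
    ultimately have s: "0 < s" "s < L" "s \<noteq> 1" by auto
    \<comment> \<open>The translate containing \<open>t\<close> does so through \<open>[0,1]\<close> if \<open>s < 1\<close>, and otherwise through
      \<open>[\<alpha>,\<beta>] = [1 + k L, L + k L]\<close>.\<close>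
    have iff: "t - of_int j * L \<in> {0..1} \<union> {\<alpha>..\<beta>} \<longleftrightarrow> (if s < 1 then j = m else j = m - k)" for j
    proof -
      have t_eq: "t - of_int j * L = s + of_int (m - j) * L" by (simp add: s_def algebra_simps)
      have A: "t - of_int j * L \<in> {0..1} \<longleftrightarrow> s < 1 \<and> j = m"
      proof
        assume "t - of_int j * L \<in> {0..1}"
        moreover from this have "m - j = 0"
          using s L unfolding t_eq atLeastAtMost_iff by (intro mult_bounds; elim conjE; linarith)
        ultimately show "s < 1 \<and> j = m" using s unfolding t_eq by auto
      qed (use s in \<open>auto simp: s_def\<close>)
      have t_eq': "t - of_int j * L - of_int k * L = s + of_int (m - k - j) * L"
        by (simp add: s_def algebra_simps)
      have "t - of_int j * L \<in> {\<alpha>..\<beta>} \<longleftrightarrow> t - of_int j * L - of_int k * L \<in> {1..L}"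
        by (auto simp: \<alpha> \<beta>)
      also have "\<dots> \<longleftrightarrow> s > 1 \<and> j = m - k"
      proof
        assume "t - of_int j * L - of_int k * L \<in> {1..L}"
        moreover from this have "m - k - j = 0"
          using s L unfolding t_eq' atLeastAtMost_iff by (intro mult_bounds; elim conjE; linarith)
        ultimately show "s > 1 \<and> j = m - k" using s unfolding t_eq' by auto
      qed (use s in \<open>auto simp: s_def algebra_simps\<close>)
      finally show ?thesis using A s by auto
    qed
    show "\<exists>!a. a \<in> range (\<lambda>m. of_int m * L) \<and> t - a \<in> {0..1} \<union> {\<alpha>..\<beta>}"
    proof (rule ex1I[of _ "of_int (if s < 1 then m else m - k) * L"])
      show "of_int (if s < 1 then m else m - k) * L \<in> range (\<lambda>m. of_int m * L)
          \<and> t - of_int (if s < 1 then m else m - k) * L \<in> {0..1} \<union> {\<alpha>..\<beta>}"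
        unfolding iff by (intro conjI rangeI) auto
    next
      fix a assume "a \<in> range (\<lambda>m. of_int m * L) \<and> t - a \<in> {0..1} \<union> {\<alpha>..\<beta>}"
      then obtain j where "a = of_int j * L" "t - of_int j * L \<in> {0..1} \<union> {\<alpha>..\<beta>}" by blast
      thus "a = of_int (if s < 1 then m else m - k) * L" unfolding iff by (auto split: if_splits)
    qed
  qed
qed

text \<open>
  The \<open>n\<close> translates by \<open>0, \<dots>, n - 1\<close> fill the interval \<open>[0,2n]\<close>, which tiles with period \<open>2n\<close>.
\<close>

lemma tiles_if_two_unit_intervals_integer_gap:
  fixes n :: int
  assumes "1 < n"
  shows "tiles_by_translations ({0..1} \<union> {of_int n..of_int n + 1})"
proof (rule tiles_by_translationsI[where N = "range of_int" and A = "of_int ` {a. a mod (2 * n) < n}"])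
  show "countable (range real_of_int)" by simp
  fix t :: real assume t: "t \<notin> range of_int"
  define q where "q = \<lfloor>t\<rfloor>"
  have "of_int q \<le> t" "t < of_int q + 1" by (simp_all add: q_def)
  moreover have "t \<noteq> of_int q" using t by auto
  ultimately have q: "of_int q < t" "t < of_int q + 1" by auto
  have unit: "t - of_int j \<in> {of_int i..of_int i + 1} \<longleftrightarrow> j = q - i" for i j
  proof
    assume "t - of_int j \<in> {of_int i..of_int i + 1}"
    hence "of_int (i + j) < (of_int (q + 1) :: real)" "of_int q < (of_int (i + j + 1) :: real)"
      using q by auto
    thus "j = q - i" unfolding of_int_less_iff by linarith
  qed (use q in auto)
  have iff: "t - of_int j \<in> {0..1} \<union> {of_int n..of_int n + 1} \<longleftrightarrow> j = q \<or> j = q - n" for j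
    using unit[of j 0] unit[of j n] by auto
  \<comment> \<open>The two candidates \<open>q\<close> and \<open>q - n\<close> lie in opposite halves of the residues modulo \<open>2n\<close>.\<close>
  have shift: "(q - n) mod (2 * n) < n \<longleftrightarrow> \<not> q mod (2 * n) < n"
  proof -
    define s where "s = q mod (2 * n)"
    have s: "0 \<le> s" "s < 2 * n" using assms by (simp_all add: s_def)
    have "(q - n) mod (2 * n) = (s - n) mod (2 * n)" by (simp add: s_def mod_simps)
    also have "\<dots> = (if s < n then s + n else s - n)"
      using s mod_pos_pos_trivial[of "s - n" "2 * n"] mod_pos_pos_trivial[of "s + n" "2 * n"]
        mod_add_self2[of "s - n" "2 * n"] by (auto simp: algebra_simps)
    finally show ?thesis using s by (auto simp: s_def)
  qed
  show "\<exists>!a. a \<in> of_int ` {a. a mod (2 * n) < n} \<and> t - a \<in> {0..1} \<union> {of_int n..of_int n + 1}"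
  proof (rule ex1I[of _ "of_int (if q mod (2 * n) < n then q else q - n)"])
    show "of_int (if q mod (2 * n) < n then q else q - n) \<in> real_of_int ` {a. a mod (2 * n) < n}
        \<and> t - of_int (if q mod (2 * n) < n then q else q - n) \<in> {0..1} \<union> {of_int n..of_int n + 1}"
      unfolding iff using shift by auto
  next
    fix a assume "a \<in> real_of_int ` {a. a mod (2 * n) < n} \<and> t - a \<in> {0..1} \<union> {of_int n..of_int n + 1}"
    then obtain j where j: "a = of_int j" "j mod (2 * n) < n"
      and "t - of_int j \<in> {0..1} \<union> {of_int n..of_int n + 1}" by blast
    hence "j = q \<or> j = q - n" unfolding iff by blast
    thus "a = of_int (if q mod (2 * n) < n then q else q - n)" using j shift by auto
  qed
qed

section \<open>Spectral unions of two intervals\<close>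

theorem corollary5p13:
  fixes \<alpha> \<beta> :: real
  assumes "1 < \<alpha>" and "\<alpha> < \<beta>"
    and "spectral_set ({0..1} \<union> {\<alpha>..\<beta>})"
  shows "tiles_by_translations ({0..1} \<union> {\<alpha>..\<beta>})"
proof -
  define \<Omega> where "\<Omega> = {0..1} \<union> {\<alpha>..\<beta>}"
  obtain \<Lambda> where meas: "\<Omega> \<in> sets lebesgue" and fin: "emeasure lebesgue \<Omega> < \<infinity>"
    and basis: "L2_orthogonal_basis (lebesgue_on \<Omega>) \<Lambda> expo"
    using assms(3) unfolding spectral_set_def \<Omega>_def by blast
  have int: "y \<in> interior \<Omega>" if "0 < y \<and> y < 1 \<or> \<alpha> < y \<and> y < \<beta>" for y
    using that interior_mono[of "{0..1}" \<Omega>] interior_mono[of "{\<alpha>..\<beta>}" \<Omega>] by (auto simp: \<Omega>_def)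
  have "\<Lambda> \<noteq> {}"
  proof
    assume "\<Lambda> = {}"
    thus False
      using expo_evaluations_independent[OF meas fin basis, of "{1/2}" "\<lambda>_. 1" 0 "1/2"] int[of "1/2"] by simp
  qed
  then obtain \<nu>\<^sub>0 where nu0: "\<nu>\<^sub>0 \<in> \<Lambda>" by blast
  define D where "D = (\<lambda>\<nu>. \<nu> - \<nu>\<^sub>0) ` \<Lambda>"
  have independent: "c y\<^sub>0 = 0"
    if "finite Y" "Y \<subseteq> interior \<Omega>" "\<And>\<delta>. \<delta> \<in> D \<Longrightarrow> (\<Sum>y\<in>Y. c y * expo \<delta> y) = 0" "y\<^sub>0 \<in> Y" for c Y y\<^sub>0
    using expo_evaluations_independent[OF meas fin basis that(1,2) _ that(4), of c \<nu>\<^sub>0] that(3)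
    by (auto simp: D_def)
  have no_period: False
    if "p \<noteq> 0" "\<And>\<delta>. \<delta> \<in> D \<Longrightarrow> expo \<delta> p = 1" "y \<in> interior \<Omega>" "y + p \<in> interior \<Omega>" for p y
    using independent[of "{y, y + p}" "\<lambda>x. if x = y then 1 else -1" y] that by (simp add: expo_add_right)
  have orth: "1 + expo (\<mu> - \<nu>) \<alpha> = expo (\<mu> - \<nu>) 1 + expo (\<mu> - \<nu>) \<beta>" if "\<mu> \<in> D" "\<nu> \<in> D" for \<mu> \<nu>
    using that orthogonal_expo_union_intervals[OF assms(1,2) basis[unfolded \<Omega>_def]]
    by (force simp: D_def)
  have "0 \<in> D" using nu0 by (force simp: D_def)
  show ?thesis
  proof (rule quadrilateral_family_trichotomy[of D "\<lambda>\<delta>. expo \<delta> \<alpha>" "\<lambda>\<delta>. expo \<delta> 1" "\<lambda>\<delta>. expo \<delta> \<beta>"])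
    fix \<mu> \<nu> assume "\<mu> \<in> D" "\<nu> \<in> D"
    thus "1 + expo \<mu> \<alpha> * cnj (expo \<nu> \<alpha>) = expo \<mu> 1 * cnj (expo \<nu> 1) + expo \<mu> \<beta> * cnj (expo \<nu> \<beta>)"
      using orth[of \<mu> \<nu>] by (simp add: expo_diff_left)
  next
    fix \<mu> assume "\<mu> \<in> D"
    thus "1 + expo \<mu> \<alpha> = expo \<mu> 1 + expo \<mu> \<beta>"
      using orth[of \<mu> 0] \<open>0 \<in> D\<close> by simp
  next
    assume one: "\<And>\<delta>. \<delta> \<in> D \<Longrightarrow> expo \<delta> 1 = 1"
    define n where "n = \<lfloor>\<alpha>\<rfloor>"
    \<comment> \<open>A point of the second interval whose fractional part lies strictly inside the first.\<close>
    define y where "y = (\<alpha> + min \<beta> (of_int n + 1)) / 2"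
    have n: "1 \<le> n" "of_int n \<le> \<alpha>" "\<alpha> < of_int n + 1"
      using assms(1) by (simp_all add: n_def le_floor_iff)
    have y: "\<alpha> < y" "y < \<beta>" "y < of_int n + 1"
      using n assms(2) by (auto simp: y_def min_def)
    have "expo \<delta> (of_int n) = 1" if "\<delta> \<in> D" for \<delta>
      using expo_int_multiple[OF one[OF that], of n] by simp
    hence False
      using no_period[of "of_int n" "y - of_int n"] n y int by auto
    thus ?thesis ..
  next
    assume right: "\<And>\<delta>. \<delta> \<in> D \<Longrightarrow> expo \<delta> 1 = expo \<delta> \<alpha> \<and> expo \<delta> \<beta> = 1"
    define L where "L = 1 + \<beta> - \<alpha>"
    define k where "k = \<lfloor>(\<alpha> - 1) / L\<rfloor>"
    define \<theta> where "\<theta> = \<alpha> - 1 - of_int k * L"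
    have L: "L > 1" using assms(2) by (simp add: L_def)
    have "of_int k \<le> (\<alpha> - 1) / L" "(\<alpha> - 1) / L < of_int k + 1" by (simp_all add: k_def)
    hence \<theta>: "0 \<le> \<theta>" "\<theta> < L" using L by (simp_all add: \<theta>_def field_simps)
    have period_\<alpha>: "expo \<delta> (\<alpha> - 1) = 1" and period_L: "expo \<delta> L = 1" if "\<delta> \<in> D" for \<delta>
      using right[OF that] by (simp_all add: L_def expo_add_right expo_diff_right)
    have period_\<theta>: "expo \<delta> \<theta> = 1" if "\<delta> \<in> D" for \<delta>
      using period_\<alpha>[OF that] expo_int_multiple[OF period_L[OF that], of k]
      unfolding \<theta>_def expo_diff_right[of \<delta> "\<alpha> - 1"] by simp
    have period_L\<theta>: "expo \<delta> (L - \<theta>) = 1" if "\<delta> \<in> D" for \<delta>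
      using period_\<theta>[OF that] period_L[OF that] by (simp add: expo_diff_right)
    \<comment> \<open>Otherwise a pair of points symmetric about the midpoint of the interval is one period apart.\<close>
    have long: "1 \<le> p" "\<beta> - \<alpha> \<le> p" if "0 < p" "\<And>\<delta>. \<delta> \<in> D \<Longrightarrow> expo \<delta> p = 1" for p
    proof -
      show "1 \<le> p"
      proof (rule ccontr)
        assume "\<not> 1 \<le> p"
        with that(1) have "0 < (1 - p) / 2" "0 < (1 - p) / 2 + p" "(1 - p) / 2 + p < 1"
          by (auto simp: field_simps)
        thus False
          using that(1) by (intro no_period[of p "(1 - p) / 2"] that(2) int) auto
      qed
      show "\<beta> - \<alpha> \<le> p"
      proof (rule ccontr)
        assume "\<not> \<beta> - \<alpha> \<le> p"
        with that(1) have "\<alpha> < (\<alpha> + \<beta> - p) / 2"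
          "\<alpha> < (\<alpha> + \<beta> - p) / 2 + p" "(\<alpha> + \<beta> - p) / 2 + p < \<beta>"
          by (auto simp: field_simps)
        thus False
          using that(1) by (intro no_period[of p "(\<alpha> + \<beta> - p) / 2"] that(2) int) auto
      qed
    qed
    show ?thesis
    proof (cases "\<theta> = 0")
      case True
      thus ?thesis
        using tiles_if_complementary_mod_length[OF assms(1,2), of k] by (simp add: \<theta>_def L_def)
    next
      case False
      have "1 \<le> \<theta>" "\<beta> - \<alpha> \<le> \<theta>" "1 \<le> L - \<theta>" "\<beta> - \<alpha> \<le> L - \<theta>"
        by (intro long period_\<theta> period_L\<theta>; use False \<theta> in simp)+
      hence \<beta>: "\<beta> = \<alpha> + 1" and "\<theta> = 1" by (auto simp: L_def)
      hence "\<alpha> = of_int (2 + 2 * k)" by (simp add: \<theta>_def L_def)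
      thus ?thesis
        using tiles_if_two_unit_intervals_integer_gap[of "2 + 2 * k"] assms(1) \<beta> by simp
    qed
  next
    fix w
    assume two: "\<And>\<delta>. \<delta> \<in> D \<Longrightarrow> expo \<delta> \<alpha> = 1 \<and> expo \<delta> 1 = 1 \<and> expo \<delta> \<beta> = 1
        \<or> expo \<delta> \<alpha> = -1 \<and> expo \<delta> 1 = w \<and> expo \<delta> \<beta> = - w"
    have period: "expo \<delta> (\<beta> - \<alpha> - 1) = 1" if "\<delta> \<in> D" for \<delta>
      using two[OF that] expo_mult_cnj[of \<delta> 1] by (auto simp: expo_diff_right)
    have \<beta>: "\<beta> = \<alpha> + 1"
    proof (rule ccontr)
      assume ne: "\<beta> \<noteq> \<alpha> + 1"
      show False
      proof (cases "\<beta> - \<alpha> > 1")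
        case True
        hence "\<alpha> + 1/2 + (\<beta> - \<alpha> - 1) \<in> interior \<Omega>" "\<alpha> + 1/2 \<in> interior \<Omega>"
          by (intro int disjI2 conjI; linarith)+
        thus False using ne by (intro no_period[of "\<beta> - \<alpha> - 1" "\<alpha> + 1/2"] period) auto
      next
        case False
        define r where "r = \<beta> - \<alpha>"
        have r: "0 < r" "r \<le> 1" using False assms(2) by (simp_all add: r_def)
        have "1 - r / 2 + (r - 1) \<in> interior \<Omega>" "1 - r / 2 \<in> interior \<Omega>"
          using r by (auto intro!: int)
        thus False using ne by (intro no_period[of "\<beta> - \<alpha> - 1" "1 - r / 2"] period) (auto simp: r_def)
      qed
    qed
    define n where "n = \<lfloor>\<alpha>\<rfloor>"
    define \<theta> where "\<theta> = \<alpha> - of_int n"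
    have \<theta>: "0 \<le> \<theta>" "\<theta> < 1" unfolding \<theta>_def n_def by linarith+
    have "\<theta> = 0"
    proof (rule ccontr)
      assume "\<theta> \<noteq> 0"
      \<comment> \<open>The value of \<open>expo \<delta> \<theta> = expo \<delta> \<alpha> / expo \<delta> n\<close> in the class with \<open>expo \<delta> \<alpha> = -1\<close>.\<close>
      define v where "v = - cnj (w powi n)"
      have \<theta>_values: "expo \<delta> \<alpha> = 1 \<and> expo \<delta> \<theta> = 1 \<or> expo \<delta> \<alpha> = -1 \<and> expo \<delta> \<theta> = v" if "\<delta> \<in> D" for \<delta>
      proof -
        have "expo \<delta> (of_int n) = expo \<delta> 1 powi n"
          by (simp add: expo_def exp_power_int algebra_simps)
        thus ?thesis using two[OF that] by (auto simp: \<theta>_def v_def expo_diff_right)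
      qed
      define y where "y = (1 - \<theta>) / 2"
      \<comment> \<open>The cross product of the value vectors \<open>(1, 1, 1)\<close> and \<open>(1, v, -1)\<close> of the two frequency classes;
        its middle entry is \<open>2\<close> whatever \<open>v\<close> is.\<close>
      define c where "c x = (if x = y then - 1 - v else if x = y + \<theta> then 2 else v - 1)" for x
      have distinct: "y \<noteq> y + \<theta>" "y \<noteq> y + \<alpha>" "y + \<theta> \<noteq> y + \<alpha>"
        using \<open>\<theta> \<noteq> 0\<close> assms(1) \<theta> by auto
      have "(\<Sum>x\<in>{y, y + \<theta>, y + \<alpha>}. c x * expo \<delta> x) = 0" if "\<delta> \<in> D" for \<delta>
      proof -
        have "(\<Sum>x\<in>{y, y + \<theta>, y + \<alpha>}. c x * expo \<delta> x)
            = expo \<delta> y * (- 1 - v + 2 * expo \<delta> \<theta> + (v - 1) * expo \<delta> \<alpha>)"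
          using distinct by (simp add: c_def expo_add_right algebra_simps)
        also have "\<dots> = 0" using \<theta>_values[OF that] by auto
        finally show ?thesis .
      qed
      moreover have "{y, y + \<theta>, y + \<alpha>} \<subseteq> interior \<Omega>"
        using \<theta> \<open>\<theta> \<noteq> 0\<close> int by (auto simp: y_def \<beta> field_simps)
      ultimately have "c (y + \<theta>) = 0"
        by (intro independent[of "{y, y + \<theta>, y + \<alpha>}" c]) simp_all
      thus False using distinct by (simp add: c_def)
    qed
    hence "\<alpha> = of_int n" by (simp add: \<theta>_def)
    thus ?thesis
      using tiles_if_two_unit_intervals_integer_gap[of n] assms(1) \<beta> by simp
  qed (rule norm_expo)+
qed

end
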